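(* Let $\{G_1'^{g_1'},G_2'^{g_2'},\ldots,G_n'^{g_n'}\}^g$ and $H_1'^{h_1'}$ be games with activeness. If $G_1'^{g_1'}=H_1'^{h_1'}$, then $\{G_1'^{g_1'},G_2'^{g_2'},\ldots,G_n'^{g_n'}\}^g=\{H_1'^{h_1'},G_2'^{g_2'},\ldots,G_n'^{g_n'}\}^g$.
   Context: Let $\mathcal{B}=\{0,1\}$. Define $\mathbb{I}_0=\{\emptyset\}\times\mathcal{B}$ and $\mathbb{I}_n=2^{\mathbb{I}_{n-1}}\times\mathcal{B}$ for $n\ge1$; a game with activeness is an element of $\mathbb{I}=\bigcup_{n\ge0}\mathbb{I}_n$. A pair $(G,g)$ is written $G^g$; elements of $G$ are its options, $g=1$ meaning active. The outcome $o$ is defined recursively: $o(G^g)=\mathscr{N}$ if $g=1$ and some option has outcome $\mathscr{P}$, and $o(G^g)=\mathscr{P}$ otherwise. The sum is $G^g+H^h=(\{G'^{g'}+H^h:G'^{g'}\in G^g\}\cup\{G^g+H'^{h'}:H'^{h'}\in H^h\})^{\max\{g,h\}}$. $G^g=H^h$ means $o(G^g+X^x)=o(H^h+X^x)$ for all games $X^x$. *)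

theory Defs
  imports "HOL-Library.FSet"
begin

text \<open>A game \<open>Game S g\<close> stands for the pair \<open>(S, g)\<close>, where \<open>g = True\<close> means active (1).
  The stages \<open>\<bbbI>\<^sub>n\<close> are finite sets, so all sets of options are finite; the datatype is the
  union of the stages, see \<open>Union_stage\<close> below.\<close>

datatype game = Game (options: "game fset") (active: bool)

primrec stage :: "nat \<Rightarrow> game set" where
  "stage 0 = {Game {||} g | g. True}"
| "stage (Suc n) = {Game S g | S g. fset S \<subseteq> stage n}"

lemma stage_mono_Suc: "stage n \<subseteq> stage (Suc n)"
proof (induction n)
  case 0
  show ?case by auto
next
  case (Suc n)
  then show ?case by fastforce
qed

lemma stage_mono: "m \<le> n \<Longrightarrow> stage m \<subseteq> stage n"
  using stage_mono_Suc by (rule lift_Suc_mono_le)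

lemma finite_stage: "finite (stage n)"
proof (induction n)
  case 0
  have "stage 0 = range (Game {||})" by auto
  then show ?case by simp
next
  case (Suc n)
  have "stage (Suc n) \<subseteq> (\<lambda>(A, g). Game (Abs_fset A) g) ` (Pow (stage n) \<times> UNIV)"
  proof
    fix x assume "x \<in> stage (Suc n)"
    then obtain S g where "x = Game S g" "fset S \<subseteq> stage n" by auto
    then show "x \<in> (\<lambda>(A, g). Game (Abs_fset A) g) ` (Pow (stage n) \<times> UNIV)"
      by (intro image_eqI[of _ _ "(fset S, g)"]) (auto simp: fset_inverse)
  qed
  with Suc show ?case by (meson finite_Pow_iff finite_SigmaI finite_imageI finite_subset finite)
qed

lemma Union_stage: "(\<Union>n. stage n) = UNIV"
proof -
  have "\<exists>n. G \<in> stage n" for G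
  proof (induction G)
    case (Game S g)
    then obtain f where f: "\<And>G. G \<in> fset S \<Longrightarrow> G \<in> stage (f G)" by metis
    have "fset S \<subseteq> stage (Max (f ` fset S))"
    proof
      fix G assume G: "G \<in> fset S"
      then have "f G \<le> Max (f ` fset S)" by simp
      with f[OF G] stage_mono show "G \<in> stage (Max (f ` fset S))" by blast
    qed
    then have "Game S g \<in> stage (Suc (Max (f ` fset S)))" by auto
    then show ?case by blast
  qed
  then show ?thesis by blast
qed

datatype outcome = \<N> | \<P>

primrec outcome_of :: "game \<Rightarrow> outcome" where
  "outcome_of (Game S g) = (if g \<and> \<P> |\<in>| outcome_of |`| S then \<N> else \<P>)"

lemma size_option: "G |\<in>| S \<Longrightarrow> size G < size (Game S g)"
  by (simp add: less_Suc_eq_le sum.remove)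

function game_sum :: "game \<Rightarrow> game \<Rightarrow> game" (infixl \<open>\<oplus>\<close> 65) where
  "Game S g \<oplus> Game T h =
     Game ((\<lambda>G'. G' \<oplus> Game T h) |`| S |\<union>| (\<lambda>H'. Game S g \<oplus> H') |`| T) (g \<or> h)"
  by pat_completeness auto
termination
  by (relation "measure (\<lambda>(G, H). size G + size H)")
    (auto simp del: game.size simp: size_option)

definition game_eq :: "game \<Rightarrow> game \<Rightarrow> bool" (infix \<open>\<doteq>\<close> 50) where
  "G \<doteq> H \<longleftrightarrow> (\<forall>X. outcome_of (G \<oplus> X) = outcome_of (H \<oplus> X))"

end

theory Submission imports Defs begin

text \<open>An outcome depends only on the activeness and the set of outcomes of the options.
  Induction on the added game \<open>X\<close> shows that these agree for both sums:
  \<open>G\<^sub>1\<close> and \<open>H\<^sub>1\<close> match by hypothesis, moves to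
  \<open>Gs\<close> are identical, and moves in \<open>X\<close> fall to the induction.\<close>

theorem theorem3p26:
  fixes G\<^sub>1 H\<^sub>1 :: game and Gs :: "game fset" and g :: bool
  assumes "G\<^sub>1 \<doteq> H\<^sub>1"
  shows "Game (finsert G\<^sub>1 Gs) g \<doteq> Game (finsert H\<^sub>1 Gs) g"
proof -
  have "outcome_of (Game (finsert G\<^sub>1 Gs) g \<oplus> X) = outcome_of (Game (finsert H\<^sub>1 Gs) g \<oplus> X)" for X
  proof (induction X)
    case (Game T x)
    have first: "outcome_of (G\<^sub>1 \<oplus> Game T x) = outcome_of (H\<^sub>1 \<oplus> Game T x)"
      using assms by (simp add: game_eq_def)
    have rest: "(\<lambda>X'. outcome_of (Game (finsert G\<^sub>1 Gs) g \<oplus> X')) |`| T =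
        (\<lambda>X'. outcome_of (Game (finsert H\<^sub>1 Gs) g \<oplus> X')) |`| T"
      using Game by (intro fset.map_cong0) simp
    show ?case
      \<comment> \<open>Pushing \<open>outcome_of\<close> through the union and the images brings
        the option outcomes into the shape of \<open>first\<close> and \<open>rest\<close>.\<close>
      by (simp add: first rest fimage_funion fset.map_comp comp_def)
  qed
  then show ?thesis
    by (simp add: game_eq_def)
qed

end
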